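(* Let $n,d$ be positive integers. For $1\le i\le m$ let $(A_i^{(1)},\ldots,A_i^{(d)})$ be a $d$-tuple of pairwise disjoint subsets of $[n]=\{1,\ldots,n\}$. Suppose that for all $1\le i<j\le m$ there exist $1\le p<q\le d$ with $A_i^{(p)}\cap A_j^{(q)}\neq\emptyset$. Then $$\sum_{i=1}^m \frac{1}{\binom{|A_i^{(1)}|+\cdots+|A_i^{(d)}|}{|A_i^{(1)}|,\ldots,|A_i^{(d)}|}}\le \binom{n+d-1}{d-1},$$ where $\binom{a_1+\cdots+a_d}{a_1,\ldots,a_d}=\frac{(a_1+\cdots+a_d)!}{a_1!\cdots a_d!}$ denotes the multinomial coefficient.
   Context: A $d$-tuple of pairwise disjoint subsets of $[n]$ is called a $d$-partition; a collection of $d$-partitions satisfying the stated condition for all $i<j$ is called a skew Bollobás system of $d$-partitions. *)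

theory Defs
  imports Complex_Main "HOL-Library.Disjoint_Sets"
begin

(* Tuples and families are functions on nat, used only at indices 1..d and 1..m.
   The components of a d-partition may be empty and need not cover {1..n}. *)

definition d_partition :: "nat \<Rightarrow> nat \<Rightarrow> (nat \<Rightarrow> nat set) \<Rightarrow> bool" where
  "d_partition n d A \<longleftrightarrow> (\<forall>p\<in>{1..d}. A p \<subseteq> {1..n}) \<and> disjoint_family_on A {1..d}"

definition skew_bollobas_system ::
    "nat \<Rightarrow> nat \<Rightarrow> nat \<Rightarrow> (nat \<Rightarrow> nat \<Rightarrow> nat set) \<Rightarrow> bool" where
  "skew_bollobas_system n d m A \<longleftrightarrow>
     (\<forall>i\<in>{1..m}. d_partition n d (A i)) \<and>
     (\<forall>i j. 1 \<le> i \<and> i < j \<and> j \<le> m \<longrightarrow>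
        (\<exists>p q. 1 \<le> p \<and> p < q \<and> q \<le> d \<and> A i p \<inter> A j q \<noteq> {}))"

definition multinomial :: "nat \<Rightarrow> (nat \<Rightarrow> nat) \<Rightarrow> real" where
  "multinomial d a = fact (\<Sum>p=1..d. a p) / (\<Prod>p=1..d. fact (a p))"

end

theory Submission
  imports Defs "HOL-Library.FuncSet"
begin

text \<open>
  Regard a map \<open>f\<close> from \<open>{1..n}\<close> to \<open>{1..d}\<close> as an ordered partition of \<open>{1..n}\<close> into the fibres
  of \<open>f\<close>, and give it the weight \<open>\<Prod>p. |f\<^sup>-\<^sup>1(p)|!\<close>. Call \<open>f\<close> compatible with \<open>i\<close> if
  \<open>A i p \<subseteq> f\<^sup>-\<^sup>1(p)\<close> for all \<open>p\<close>. By the skew condition no \<open>f\<close> is compatible with two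
  different indices. If \<open>s\<close> is the total size of the \<open>i\<close>-th tuple, adding the remaining elements one
  at a time shows that the maps compatible with \<open>i\<close> have total weight
  \<open>(\<Prod>p. |A i p|!) (s + d) (s + d + 1) \<dots> (n + d - 1)\<close>, which is at least
  \<open>n! / multinomial\<close>, while all maps together have total weight \<open>d (d + 1) \<dots> (n + d - 1)\<close>.
\<close>

text \<open>For \<open>f\<close> mapping \<open>X\<close> into \<open>D\<close>, this counts the
  ways to order every fibre linearly; summed over all such \<open>f\<close>, it counts the
  placements of the points of \<open>X\<close> on \<open>card D\<close> ordered lines.\<close>

definition fibre_weight :: "'b set \<Rightarrow> 'a set \<Rightarrow> ('a \<Rightarrow> 'b) \<Rightarrow> real" where
  "fibre_weight D X f = (\<Prod>p\<in>D. fact (card {x\<in>X. f x = p}))"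

definition extensions :: "'b set \<Rightarrow> 'a set \<Rightarrow> ('a \<Rightarrow> 'b) \<Rightarrow> 'a set \<Rightarrow> ('a \<Rightarrow> 'b) set" where
  "extensions D U g X = (\<Pi>\<^sub>E x\<in>X. if x \<in> U then {g x} else D)"

lemma fibre_weight_nonneg: "fibre_weight D X f \<ge> 0"
  unfolding fibre_weight_def by (intro prod_nonneg) simp

lemma fibre_weight_cong:
  "(\<And>x. x \<in> X \<Longrightarrow> f x = g x) \<Longrightarrow> fibre_weight D X f = fibre_weight D X g"
  unfolding fibre_weight_def by (intro prod.cong refl arg_cong[of _ _ "\<lambda>Y. fact (card Y)"]) auto

lemma fibre_weight_insert:
  assumes "finite D" "finite X" "x \<notin> X" "y \<in> D"
  shows "fibre_weight D (insert x X) (f(x := y)) =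
    fibre_weight D X f * (1 + real (card {z\<in>X. f z = y}))"
proof -
  have eq: "{z \<in> insert x X. (f(x := y)) z = p} =
      (if p = y then insert x {z\<in>X. f z = y} else {z\<in>X. f z = p})" for p
    using assms(3) by auto
  have "fibre_weight D (insert x X) (f(x := y)) =
      fact (card (insert x {z\<in>X. f z = y})) * (\<Prod>p\<in>D-{y}. fact (card {z\<in>X. f z = p}))"
    unfolding fibre_weight_def eq prod.remove[OF assms(1,4)] by simp
  also have "card (insert x {z\<in>X. f z = y}) = Suc (card {z\<in>X. f z = y})"
    using assms(2,3) by simp
  finally show ?thesis
    unfolding fibre_weight_def prod.remove[OF assms(1,4)] by (simp add: algebra_simps)
qed

lemma sum_card_fibres:
  assumes "finite D" "finite X" "f \<in> X \<rightarrow> D"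
  shows "(\<Sum>y\<in>D. card {z\<in>X. f z = y}) = card X"
proof -
  have "card (\<Union>y\<in>D. {z\<in>X. f z = y}) = (\<Sum>y\<in>D. card {z\<in>X. f z = y})"
    using assms by (intro card_UN_disjoint) auto
  moreover have "(\<Union>y\<in>D. {z\<in>X. f z = y}) = X"
    using assms(3) by auto
  ultimately show ?thesis by simp
qed

text \<open>Sending a new point to \<open>y\<close> multiplies the weight by one plus the size of
  the fibre over \<open>y\<close>. Summed over \<open>y\<close>, this gives \<open>card D\<close>
  plus the number of points already placed, whatever \<open>f\<close> is. These consecutive factors
  build the rising factorial.\<close>

lemma sum_fibre_weight_extensions:
  assumes "finite D" "finite U" "finite S" "U \<inter> S = {}" "g \<in> U \<rightarrow> D"
  shows "(\<Sum>f\<in>extensions D U g (U \<union> S). fibre_weight D (U \<union> S) f) =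
    fibre_weight D U g * pochhammer (real (card U + card D)) (card S)"
  using assms(3,4)
proof (induction S rule: finite_induct)
  case empty
  obtain h where h: "extensions D U g U = {h}" "\<And>x. x \<in> U \<Longrightarrow> h x = g x"
  proof
    show "extensions D U g U = {restrict g U}"
      unfolding extensions_def by (auto simp: PiE_iff extensional_def)
  qed simp
  have "fibre_weight D U h = fibre_weight D U g"
    using h(2) by (rule fibre_weight_cong)
  then show ?case by (simp add: h(1))
next
  case (insert x S)
  let ?X = "U \<union> S" and ?E = "extensions D U g"
  have x: "x \<notin> ?X" using insert by auto
  have fin: "finite ?X" using assms(2) insert by simp
  \<comment> \<open>Since \<open>x\<close> lies outside \<open>U\<close>, its value is free: a map
    on the larger set is a value at \<open>x\<close> paired with a map on \<open>?X\<close>.\<close>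
  have E: "?E (insert x ?X) = (\<lambda>(y, f). f(x := y)) ` (D \<times> ?E ?X)"
    unfolding extensions_def PiE_insert_eq using x by simp
  have inj: "inj_on (\<lambda>(y, f). f(x := y)) (D \<times> ?E ?X)"
    unfolding extensions_def using inj_combinator[OF x, of "\<lambda>x. if x \<in> U then {g x} else D"] x
    by simp
  have maps: "f \<in> ?X \<rightarrow> D" if "f \<in> ?E ?X" for f
  proof
    fix x assume "x \<in> ?X"
    then have "f x \<in> (if x \<in> U then {g x} else D)"
      using that unfolding extensions_def by (rule PiE_mem[rotated])
    then show "f x \<in> D"
      using assms(5) by (cases "x \<in> U") auto
  qed
  have "(\<Sum>f\<in>?E (U \<union> insert x S). fibre_weight D (U \<union> insert x S) f) =
      (\<Sum>(y, f)\<in>D \<times> ?E ?X. fibre_weight D (insert x ?X) (f(x := y)))"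
    unfolding Un_insert_right E sum.reindex[OF inj] by (simp add: case_prod_unfold)
  also have "\<dots> = (\<Sum>f\<in>?E ?X. \<Sum>y\<in>D. fibre_weight D (insert x ?X) (f(x := y)))"
    unfolding sum.cartesian_product[symmetric] by (rule sum.swap)
  also have "\<dots> = (\<Sum>f\<in>?E ?X. fibre_weight D ?X f * (card D + card ?X))"
  proof (rule sum.cong[OF refl])
    fix f assume "f \<in> ?E ?X"
    have "(\<Sum>y\<in>D. fibre_weight D (insert x ?X) (f(x := y))) =
        (\<Sum>y\<in>D. fibre_weight D ?X f * (1 + real (card {z\<in>?X. f z = y})))"
      by (intro sum.cong refl fibre_weight_insert assms fin x)
    also have "\<dots> = fibre_weight D ?X f * (card D + real (\<Sum>y\<in>D. card {z\<in>?X. f z = y}))"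
      by (simp add: sum_distrib_left[symmetric] sum.distrib)
    finally show "(\<Sum>y\<in>D. fibre_weight D (insert x ?X) (f(x := y))) =
        fibre_weight D ?X f * (card D + card ?X)"
      unfolding sum_card_fibres[OF assms(1) fin maps[OF \<open>f \<in> ?E ?X\<close>]] by simp
  qed
  also have "\<dots> = fibre_weight D U g * pochhammer (real (card U + card D)) (card S) *
      (card D + card ?X)"
    using insert by (simp add: sum_distrib_right[symmetric])
  also have "card ?X = card U + card S"
    using insert assms(2) by (intro card_Un_disjoint) auto
  finally show ?case
    using insert by (simp add: pochhammer_Suc algebra_simps)
qed

text \<open>Factor by factor, \<open>s + 1 + i\<close> \<le> \<open>s + d + i\<close>.\<close>

lemma fact_le_fact_mult_pochhammer:
  assumes "d \<ge> 1"
  shows "fact (s + k) \<le> (fact s * pochhammer (real (s + d)) k :: real)"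
proof (induction k)
  case (Suc k)
  have "fact (s + Suc k) = (fact (s + k) * (real s + 1 + real k) :: real)"
    by (simp add: algebra_simps)
  also have "\<dots> \<le> fact s * pochhammer (real (s + d)) k * (real (s + d) + real k)"
    using assms Suc by (intro mult_mono) (auto intro!: mult_nonneg_nonneg pochhammer_nonneg)
  finally show ?case by (simp add: pochhammer_Suc)
qed simp

text \<open>Both sides are (n+d-1)! / (d-1)!.\<close>

lemma fact_mult_binomial_eq_pochhammer:
  assumes "d \<ge> 1"
  shows "fact n * real ((n + d - 1) choose (d - 1)) = pochhammer (real d) n"
proof -
  have "(fact (n + d - 1) :: real) = fact (d - 1) * pochhammer (real d) n"
    using assms
  proof (induction n)
    case (Suc n)
    then have "(fact (Suc n + d - 1) :: real) = (real n + real d) * fact (n + d - 1)"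
      by (cases d) (auto simp: algebra_simps)
    then show ?case using Suc by (simp add: pochhammer_Suc algebra_simps)
  qed simp
  then show ?thesis
    using assms by (simp add: binomial_fact)
qed

text \<open>The prescribed part has weight \<Prod>p. |A p|!, which is s! divided by the multinomial
  coefficient, where s is the total size. Placing the other n-s points contributes a rising
  factorial of at least n!/s!.\<close>

lemma fact_div_multinomial_le:
  assumes "d \<ge> 1" "d_partition n d A"
  obtains g where "\<And>p x. p \<in> {1..d} \<Longrightarrow> x \<in> A p \<Longrightarrow> g x = p"
    and "fact n / multinomial d (\<lambda>p. card (A p)) \<le>
      (\<Sum>f\<in>extensions {1..d} (\<Union>p\<in>{1..d}. A p) g {1..n}. fibre_weight {1..d} {1..n} f)"
proof -
  let ?D = "{1..d}" and ?X = "{1..n}"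
  define U where "U = (\<Union>p\<in>?D. A p)"
  \<comment> \<open>Disjointness makes the label unique on \<open>U\<close>. Elsewhere
    \<open>g\<close> is unspecified, but only its values on \<open>U\<close> are ever used.\<close>
  define g where "g x = (THE p. p \<in> ?D \<and> x \<in> A p)" for x
  have sub: "A p \<subseteq> ?X" if "p \<in> ?D" for p
    using assms(2) that unfolding d_partition_def by blast
  have dis: "disjoint_family_on A ?D"
    using assms(2) unfolding d_partition_def by blast
  have g: "g x = p" if "p \<in> ?D" "x \<in> A p" for p x
    unfolding g_def
  proof (rule the_equality)
    show "q = p" if "q \<in> ?D \<and> x \<in> A q" for q
      using that \<open>p \<in> ?D\<close> \<open>x \<in> A p\<close> disjoint_family_onD[OF dis, of q p] by blast
  qed (use that in simp)
  have UX: "U \<subseteq> ?X" using sub unfolding U_def by blast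
  then have finU: "finite U" by (rule finite_subset) simp
  have fib: "{x\<in>U. g x = p} = A p" if "p \<in> ?D" for p
    using that g unfolding U_def by auto
  have gU: "g \<in> U \<rightarrow> ?D" using g unfolding U_def by auto
  define s where "s = card U"
  have s: "s = (\<Sum>p\<in>?D. card (A p))"
    using sum_card_fibres[OF _ finU gU] fib by (simp add: s_def)
  have "s + card (?X - U) = n"
    \<comment> \<open>\<open>card_mono\<close> gives \<open>s\<close> \<le> \<open>n\<close>, so the
      natural subtraction does not truncate.\<close>
    using card_Diff_subset[OF finU UX] card_mono[OF _ UX] by (simp add: s_def)
  then have "fact n \<le> (fact s * pochhammer (real (s + d)) (card (?X - U)) :: real)"
    using fact_le_fact_mult_pochhammer[OF assms(1), of s "card (?X - U)"] by simp
  then have "fact n / fact s \<le> pochhammer (real (s + d)) (card (?X - U))"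
    by (simp add: divide_le_eq mult.commute)
  then have "fibre_weight ?D U g * (fact n / fact s) \<le>
      fibre_weight ?D U g * pochhammer (real (s + d)) (card (?X - U))"
    by (intro mult_left_mono fibre_weight_nonneg)
  also have "fibre_weight ?D U g * (fact n / fact s) =
      fact n / multinomial d (\<lambda>p. card (A p))"
    using fib by (simp add: fibre_weight_def multinomial_def s)
  also have "fibre_weight ?D U g * pochhammer (real (s + d)) (card (?X - U)) =
      (\<Sum>f\<in>extensions ?D U g ?X. fibre_weight ?D ?X f)"
    using sum_fibre_weight_extensions[of ?D U "?X - U" g] finU gU UX
    by (simp add: s_def Un_absorb1)
  finally show ?thesis
    unfolding U_def by (intro that[of g] g)
qed

theorem theorem7:
  fixes n d m :: nat and A :: "nat \<Rightarrow> nat \<Rightarrow> nat set"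
  assumes "n \<ge> 1" and "d \<ge> 1"
    and "skew_bollobas_system n d m A"
  shows "(\<Sum>i=1..m. 1 / multinomial d (\<lambda>p. card (A i p))) \<le> real ((n + d - 1) choose (d - 1))"
proof -
  let ?D = "{1..d}" and ?X = "{1..n}"
  let ?w = "fibre_weight ?D ?X"
  have part: "d_partition n d (A i)" if "i \<in> {1..m}" for i
    using assms(3) that unfolding skew_bollobas_system_def by blast
  have "\<forall>i\<in>{1..m}. \<exists>g. (\<forall>p\<in>?D. \<forall>x\<in>A i p. g x = p) \<and>
      fact n / multinomial d (\<lambda>p. card (A i p)) \<le>
      (\<Sum>f\<in>extensions ?D (\<Union>p\<in>?D. A i p) g ?X. ?w f)"
    by (metis fact_div_multinomial_le[OF assms(2) part])
  then obtain g where g: "\<And>i p x. i \<in> {1..m} \<Longrightarrow> p \<in> ?D \<Longrightarrow> x \<in> A i p \<Longrightarrow> g i x = p"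
    and le: "\<And>i. i \<in> {1..m} \<Longrightarrow> fact n / multinomial d (\<lambda>p. card (A i p)) \<le>
      (\<Sum>f\<in>extensions ?D (\<Union>p\<in>?D. A i p) (g i) ?X. ?w f)"
    by metis
  define T where "T i = extensions ?D (\<Union>p\<in>?D. A i p) (g i) ?X" for i
  have T_sub: "T i \<subseteq> (?X \<rightarrow>\<^sub>E ?D)" if "i \<in> {1..m}" for i
    unfolding T_def extensions_def using that by (intro PiE_mono) (auto simp: g)
  have T_val: "f x = p" if "f \<in> T i" "i \<in> {1..m}" "p \<in> ?D" "x \<in> A i p" for f i p x
  proof -
    have "x \<in> ?X" using part that unfolding d_partition_def by blast
    moreover have "x \<in> (\<Union>p\<in>?D. A i p)" using that by blast
    ultimately have "f x \<in> {g i x}"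
      using PiE_mem[OF \<open>f \<in> T i\<close>[unfolded T_def extensions_def], of x] by (simp only: if_True)
    then show ?thesis using g that by simp
  qed
  \<comment> \<open>A common element of \<open>A i p\<close> and \<open>A j q\<close> would have to
    be sent to both \<open>p\<close> and \<open>q\<close>, although \<open>p < q\<close>.\<close>
  have disj: "T i \<inter> T j = {}" if ij: "i \<in> {1..m}" "j \<in> {1..m}" "i < j" for i j
  proof -
    have "1 \<le> i \<and> i < j \<and> j \<le> m" using ij by simp
    then obtain p q where pq: "1 \<le> p" "p < q" "q \<le> d" and "A i p \<inter> A j q \<noteq> {}"
      using assms(3) unfolding skew_bollobas_system_def by blast
    then obtain x where "x \<in> A i p" "x \<in> A j q" by blast
    moreover have "p \<in> ?D" "q \<in> ?D" using pq by auto
    ultimately have "f x = p" "f x = q" if "f \<in> T i" "f \<in> T j" for f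
      using T_val ij that by blast+
    with \<open>p < q\<close> show ?thesis by fastforce
  qed
  have fin: "finite (?X \<rightarrow>\<^sub>E ?D)" by (intro finite_PiE) auto
  have "fact n * (\<Sum>i=1..m. 1 / multinomial d (\<lambda>p. card (A i p))) \<le> (\<Sum>i=1..m. \<Sum>f\<in>T i. ?w f)"
    using le by (auto simp: sum_distrib_left T_def intro!: sum_mono)
  also have "\<dots> = (\<Sum>f\<in>(\<Union>i\<in>{1..m}. T i). ?w f)"
  proof (rule sum.UNION_disjoint[symmetric])
    show "\<forall>i\<in>{1..m}. finite (T i)" using T_sub fin finite_subset by blast
    \<comment> \<open>The skew condition speaks only of \<open>i < j\<close>, but disjointness is
      symmetric, so this covers all pairs.\<close>
    show "\<forall>i\<in>{1..m}. \<forall>j\<in>{1..m}. i \<noteq> j \<longrightarrow> T i \<inter> T j = {}"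
      using disj by (metis inf_commute linorder_neqE_nat)
  qed simp
  also have "\<dots> \<le> (\<Sum>f\<in>?X \<rightarrow>\<^sub>E ?D. ?w f)"
  proof (rule sum_mono2[OF fin])
    show "(\<Union>i\<in>{1..m}. T i) \<subseteq> (?X \<rightarrow>\<^sub>E ?D)" using T_sub by (rule UN_least)
  qed (rule fibre_weight_nonneg)
  \<comment> \<open>With nothing prescribed (\<open>U = {}\<close>), the extensions are all maps,
    the labelling is arbitrary and the initial weight is an empty-fibre product equal to 1.\<close>
  also have "\<dots> = pochhammer (real d) n"
    using sum_fibre_weight_extensions[of ?D "{}" ?X undefined]
    by (simp add: extensions_def fibre_weight_def)
  also have "\<dots> = fact n * real ((n + d - 1) choose (d - 1))"
    using fact_mult_binomial_eq_pochhammer[OF assms(2)] by simp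
  finally show ?thesis by simp
qed

end
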